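(* Let $X\subseteq\mathbb{R}^n$ be nonempty and compact, let $b:X\to\mathbb{R}$ and $q:X\to\mathbb{R}^p$ be continuous, let $d_1,\dots,d_N\in\mathbb{R}^p$, and let $r>0$. Then for any subset $S\subseteq[N]$ and any $\varepsilon$-net $\mathcal{T}$ of $q(X)$ in the pseudometric $d_{\mathcal{D}}$, $$\min_{x\in X}\Phi_{[N]}(x)-\min_{x\in X}\Phi_S(x)\ \le\ r\Big(\max_{s\in\mathcal{T}}\Delta_S(s)+2\varepsilon\Big).$$
   Context: $[N]=\{1,\dots,N\}$, $[N]_0=\{0,1,\dots,N\}$, $d_0:=0\in\mathbb{R}^p$ (null atom), and $\mathcal{D}=\{d_1,\dots,d_N\}$ is the dictionary. For $S\subseteq[N]$, $S_0:=S\cup\{0\}$. The atomic uncertainty set is $U_S(r)=\{u=\sum_{i\in S}\alpha_i d_i:\alpha_i\ge 0,\ \sum_{i\in S}\alpha_i\le r\}$. With $f(x,u)=b(x)+\langle u,q(x)\rangle$, the robust objective is $$\Phi_S(x):=\sup_{u\in U_S(r)}f(x,u)=b(x)+r\max_{i\in S_0}\langle d_i,q(x)\rangle ,$$ and $\Phi_{[N]}$ is the case $S=[N]$. The alignment deficit is $\Delta_S(s):=\max_{i\in[N]_0}\langle d_i,s\rangle-\max_{i\in S_0}\langle d_i,s\rangle$ for $s\in\mathbb{R}^p$. The pseudometric is $d_{\mathcal{D}}(s,s'):=\max_{i\in[N]_0}|\langle d_i,s-s'\rangle|$. A finite set $\mathcal{T}\subset\mathbb{R}^p$ is an $\varepsilon$-net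 of $q(X)$ in $d_{\mathcal{D}}$ if for every $x\in X$ there is $s\in\mathcal{T}$ with $d_{\mathcal{D}}(q(x),s)\le\varepsilon$. *)

theory Defs
  imports "HOL-Analysis.Analysis"
begin

text \<open>
  The atoms \<open>d\<^sub>1, \<dots>, d\<^sub>N\<close> are given by a function on \<^typ>\<open>nat\<close> of which only the values on
  \<open>{1..N}\<close> are used; \<open>atom d\<close> overrides the value at index \<open>0\<close> by the null atom.
\<close>

definition atom :: "(nat \<Rightarrow> real ^ 'p) \<Rightarrow> nat \<Rightarrow> real ^ 'p" where
  "atom d i = (if i = 0 then 0 else d i)"

definition uncertainty_set :: "(nat \<Rightarrow> real ^ 'p) \<Rightarrow> real \<Rightarrow> nat set \<Rightarrow> (real ^ 'p) set" where
  "uncertainty_set d r S =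
     {u. \<exists>\<alpha> :: nat \<Rightarrow> real. (\<forall>i\<in>S. 0 \<le> \<alpha> i) \<and> (\<Sum>i\<in>S. \<alpha> i) \<le> r \<and> u = (\<Sum>i\<in>S. \<alpha> i *\<^sub>R d i)}"

definition objective ::
  "(real ^ 'n \<Rightarrow> real) \<Rightarrow> (real ^ 'n \<Rightarrow> real ^ 'p) \<Rightarrow> real ^ 'n \<Rightarrow> real ^ 'p \<Rightarrow> real" where
  "objective b q x u = b x + u \<bullet> q x"

definition robust_objective ::
  "(real ^ 'n \<Rightarrow> real) \<Rightarrow> (real ^ 'n \<Rightarrow> real ^ 'p) \<Rightarrow> (nat \<Rightarrow> real ^ 'p) \<Rightarrow> real \<Rightarrow> nat set
     \<Rightarrow> real ^ 'n \<Rightarrow> real" where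
  "robust_objective b q d r S x = (SUP u \<in> uncertainty_set d r S. objective b q x u)"

definition alignment_deficit ::
  "(nat \<Rightarrow> real ^ 'p) \<Rightarrow> nat \<Rightarrow> nat set \<Rightarrow> real ^ 'p \<Rightarrow> real" where
  "alignment_deficit d N S s =
     (MAX i\<in>{0..N}. atom d i \<bullet> s) - (MAX i\<in>insert 0 S. atom d i \<bullet> s)"

definition dict_dist ::
  "(nat \<Rightarrow> real ^ 'p) \<Rightarrow> nat \<Rightarrow> real ^ 'p \<Rightarrow> real ^ 'p \<Rightarrow> real" where
  "dict_dist d N s s' = (MAX i\<in>{0..N}. \<bar>atom d i \<bullet> (s - s')\<bar>)"

text \<open>The points of a net need not lie in the set \<open>A\<close> that is covered.\<close>

definition is_net ::
  "(nat \<Rightarrow> real ^ 'p) \<Rightarrow> nat \<Rightarrow> real \<Rightarrow> (real ^ 'p) set \<Rightarrow> (real ^ 'p) set \<Rightarrow> bool" where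
  "is_net d N \<epsilon> A T \<longleftrightarrow> finite T \<and> (\<forall>a\<in>A. \<exists>s\<in>T. dict_dist d N a s \<le> \<epsilon>)"

end

theory Submission
  imports Defs
begin

text \<open>
  If \<open>y\<close> minimises \<open>\<Phi>\<^sub>S\<close>, then \<open>min \<Phi>\<^bsub>[N]\<^esub> - min \<Phi>\<^sub>S \<le> \<Phi>\<^bsub>[N]\<^esub> y - \<Phi>\<^sub>S y = r \<cdot> \<Delta>\<^sub>S (q y)\<close>.
  Both maxima in \<open>\<Delta>\<^sub>S\<close> change by at most \<open>\<epsilon>\<close> when \<open>q y\<close> is replaced by a point of
  the net at \<open>dict_dist\<close> at most \<open>\<epsilon>\<close> from it.
\<close>

text \<open>For finite \<open>S\<close> this is the support function of the convex hull of the
  origin and the atoms indexed by \<open>S\<close>. Both maxima in \<open>alignment_deficit\<close>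
  are instances of it.\<close>

definition atom_max :: "(nat \<Rightarrow> real ^ 'p) \<Rightarrow> nat set \<Rightarrow> real ^ 'p \<Rightarrow> real" where
  "atom_max d S s = (MAX i\<in>insert 0 S. atom d i \<bullet> s)"

text \<open>One half of the fact that a finite maximum is 1-Lipschitz in the sup norm; exchanging
  \<open>f\<close> and \<open>g\<close> gives the other half.\<close>

lemma Max_image_le_add:
  fixes f g :: "'a \<Rightarrow> real"
  assumes "finite I" and "I \<noteq> {}" and "\<And>i. i \<in> I \<Longrightarrow> f i \<le> g i + e"
  shows "Max (f ` I) \<le> Max (g ` I) + e"
proof -
  have "f i \<le> Max (g ` I) + e" if "i \<in> I" for i
  proof -
    have "g i \<le> Max (g ` I)"
      using that assms(1) by simp
    then show ?thesis
      using assms(3)[OF that] by linarith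
  qed
  then show ?thesis
    using assms by simp
qed

lemma continuous_on_Max_image:
  fixes f :: "'a \<Rightarrow> 'b::topological_space \<Rightarrow> real"
  assumes "finite I" and "I \<noteq> {}" and "\<And>i. i \<in> I \<Longrightarrow> continuous_on A (f i)"
  shows "continuous_on A (\<lambda>x. MAX i\<in>I. f i x)"
  using assms
proof (induction I rule: finite_ne_induct)
  case (insert i I)
  then show ?case
    by (simp add: continuous_on_max)
qed simp

lemma atom_max_ge:
  assumes "finite S" and "i \<in> insert 0 S"
  shows "atom d i \<bullet> s \<le> atom_max d S s"
  using assms unfolding atom_max_def by (intro Max_ge) auto

lemma atom_max_nonneg: "finite S \<Longrightarrow> 0 \<le> atom_max d S s"
  using atom_max_ge[of S 0 d s] by (simp add: atom_def)

lemma atom_max_attained: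
  assumes "finite S"
  obtains i where "i \<in> insert 0 S" and "atom_max d S s = atom d i \<bullet> s"
proof -
  have "atom_max d S s \<in> (\<lambda>i. atom d i \<bullet> s) ` insert 0 S"
    unfolding atom_max_def using assms by (intro Max_in) auto
  then show thesis
    using that by blast
qed

text \<open>Bounding each \<open>d i \<bullet> s\<close> by \<open>atom_max d S s\<close> leaves the
  total weight as a factor. That total may stay below \<open>r\<close>, which does no harm because
  the null atom makes \<open>atom_max\<close> nonnegative. With \<open>0 \<notin> S\<close> the
  vectors \<open>d i\<close> are genuine atoms, whatever the value \<open>d 0\<close> is.\<close>

lemma inner_uncertainty_le:
  assumes "finite S" and "0 \<notin> S" and "u \<in> uncertainty_set d r S"
  shows "u \<bullet> s \<le> r * atom_max d S s"
proof -
  obtain \<alpha> where \<alpha>: "\<And>i. i \<in> S \<Longrightarrow> 0 \<le> \<alpha> i" "(\<Sum>i\<in>S. \<alpha> i) \<le> r"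
    and u: "u = (\<Sum>i\<in>S. \<alpha> i *\<^sub>R d i)"
    using assms(3) unfolding uncertainty_set_def by blast
  have "u \<bullet> s = (\<Sum>i\<in>S. \<alpha> i * (d i \<bullet> s))"
    by (simp add: u inner_sum_left)
  also have "\<dots> \<le> (\<Sum>i\<in>S. \<alpha> i * atom_max d S s)"
  proof (intro sum_mono mult_left_mono)
    fix i assume "i \<in> S"
    then have "atom d i = d i"
      using assms(2) by (auto simp: atom_def)
    then show "d i \<bullet> s \<le> atom_max d S s"
      using atom_max_ge[OF assms(1), of i d s] \<open>i \<in> S\<close> by simp
  qed (use \<alpha> in auto)
  also have "\<dots> = (\<Sum>i\<in>S. \<alpha> i) * atom_max d S s"
    by (simp add: sum_distrib_right)
  also have "\<dots> \<le> r * atom_max d S s"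
    using \<alpha>(2) atom_max_nonneg[OF assms(1)] by (rule mult_right_mono)
  finally show ?thesis .
qed

text \<open>These points attain the bound of \<open>inner_uncertainty_le\<close>: the whole budget
  \<open>r\<close> goes to a single atom, and the null atom is reached with all weights
  zero.\<close>

lemma scaled_atom_in_uncertainty_set:
  assumes "finite S" and "r \<ge> 0" and "i \<in> insert 0 S"
  shows "r *\<^sub>R atom d i \<in> uncertainty_set d r S"
proof (cases "i = 0")
  case True
  then show ?thesis
    using assms(2) by (auto simp: uncertainty_set_def atom_def intro!: exI[of _ "\<lambda>_. 0"])
next
  case False
  then have "i \<in> S"
    using assms(3) by simp
  let ?\<alpha> = "\<lambda>j. if j = i then r else 0"
  have "(\<Sum>j\<in>S. ?\<alpha> j) = r"
    using assms(1) \<open>i \<in> S\<close> by simp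
  moreover have "(\<Sum>j\<in>S. ?\<alpha> j *\<^sub>R d j) = r *\<^sub>R atom d i"
    using assms(1) \<open>i \<in> S\<close> False by (simp add: if_distrib[of "\<lambda>c. c *\<^sub>R _"] atom_def cong: if_cong)
  ultimately show ?thesis
    unfolding uncertainty_set_def using assms(2)
    by (intro CollectI exI[of _ ?\<alpha>]) simp
qed

text \<open>A linear functional is maximal at a scaled atom \<open>r *\<^sub>R atom d i\<close>,
  where \<open>i\<close> attains \<open>atom_max\<close>. The supremum is thus a maximum, which also
  settles boundedness.\<close>

lemma robust_objective_eq:
  assumes "finite S" and "0 \<notin> S" and "r \<ge> 0"
  shows "robust_objective b q d r S x = b x + r * atom_max d S (q x)"
proof -
  obtain i where i: "i \<in> insert 0 S" "atom_max d S (q x) = atom d i \<bullet> q x"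
    using atom_max_attained[OF assms(1)] .
  have "b x + r * atom_max d S (q x) = objective b q x (r *\<^sub>R atom d i)"
    by (simp add: objective_def i(2))
  then have "b x + r * atom_max d S (q x) \<in> objective b q x ` uncertainty_set d r S"
    using scaled_atom_in_uncertainty_set[OF assms(1,3) i(1)] by blast
  then show ?thesis
    unfolding robust_objective_def
    by (rule cSup_eq_maximum)
      (auto simp: objective_def intro: inner_uncertainty_le[OF assms(1,2)])
qed

text \<open>The closed form turns the supremum over an infinite set into a finite maximum of
  continuous functions, so the extreme value theorem applies on the compact set
  \<open>X\<close>.\<close>

lemma robust_objective_attains_min:
  assumes "compact X" and "X \<noteq> {}" and "continuous_on X b" and "continuous_on X q"
    and "finite S" and "0 \<notin> S" and "r \<ge> 0"
  obtains x where "is_arg_min (robust_objective b q d r S) (\<lambda>z. z \<in> X) x"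
proof -
  have "continuous_on X (\<lambda>x. b x + r * atom_max d S (q x))"
    unfolding atom_max_def using assms
    by (intro continuous_intros continuous_on_Max_image) auto
  then obtain x where "x \<in> X"
    "\<forall>y\<in>X. b x + r * atom_max d S (q x) \<le> b y + r * atom_max d S (q y)"
    using continuous_attains_inf[OF assms(1,2)] by blast
  then show thesis
    using that by (force simp: is_arg_min_linorder robust_objective_eq[OF assms(5-7)])
qed

lemma alignment_deficit_eq:
  "alignment_deficit d N S s = atom_max d {1..N} s - atom_max d S s"
proof -
  have "{0..N} = insert 0 {1..N}"
    by auto
  then show ?thesis
    by (simp only: alignment_deficit_def atom_max_def)
qed

text \<open>Since \<open>S \<subseteq> {0..N}\<close>, every index in the maximum is also one over
  which \<open>dict_dist\<close> is taken, so each term moves by at most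
  \<open>dict_dist d N s s'\<close>.\<close>

lemma atom_max_diff_le_dict_dist:
  assumes "S \<subseteq> {0..N}"
  shows "\<bar>atom_max d S s - atom_max d S s'\<bar> \<le> dict_dist d N s s'"
proof -
  have fin: "finite (insert 0 S)"
    using assms finite_subset by blast
  have "\<bar>atom d i \<bullet> (s - s')\<bar> \<le> dict_dist d N s s'" if "i \<in> insert 0 S" for i
    unfolding dict_dist_def using that assms by (intro Max_ge) auto
  then have *: "\<bar>atom d i \<bullet> s - atom d i \<bullet> s'\<bar> \<le> dict_dist d N s s'" if "i \<in> insert 0 S" for i
    using that by (simp add: inner_diff_right)
  have "atom_max d S s \<le> atom_max d S s' + dict_dist d N s s'"
    unfolding atom_max_def by (rule Max_image_le_add[OF fin]) (use * in \<open>force+\<close>)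
  moreover have "atom_max d S s' \<le> atom_max d S s + dict_dist d N s s'"
    unfolding atom_max_def by (rule Max_image_le_add[OF fin]) (use * in \<open>force+\<close>)
  ultimately show ?thesis
    by linarith
qed

lemma alignment_deficit_le_dict_dist:
  assumes "S \<subseteq> {0..N}"
  shows "alignment_deficit d N S s \<le> alignment_deficit d N S s' + 2 * dict_dist d N s s'"
  using atom_max_diff_le_dict_dist[OF assms, of d s s']
    atom_max_diff_le_dict_dist[of "{1..N}" N d s s']
  unfolding alignment_deficit_eq by simp

theorem theorem3p1:
  fixes X :: "(real ^ 'n) set"
    and b :: "real ^ 'n \<Rightarrow> real"
    and q :: "real ^ 'n \<Rightarrow> real ^ 'p"
    and d :: "nat \<Rightarrow> real ^ 'p"
    and N :: nat
    and r \<epsilon> :: real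
    and S :: "nat set"
    and T :: "(real ^ 'p) set"
  assumes "X \<noteq> {}" and "compact X"
    and "continuous_on X b" and "continuous_on X q"
    and "r > 0"
    and "S \<subseteq> {1..N}"
    and "is_net d N \<epsilon> (q ` X) T"
  shows "\<exists>x y. is_arg_min (robust_objective b q d r {1..N}) (\<lambda>z. z \<in> X) x
             \<and> is_arg_min (robust_objective b q d r S) (\<lambda>z. z \<in> X) y
             \<and> robust_objective b q d r {1..N} x - robust_objective b q d r S y
                 \<le> r * ((MAX s\<in>T. alignment_deficit d N S s) + 2 * \<epsilon>)"
proof -
  have S: "finite S" "0 \<notin> S" "S \<subseteq> {0..N}"
    using \<open>S \<subseteq> {1..N}\<close> by (auto intro: finite_subset)
  have "r \<ge> 0"
    using \<open>r > 0\<close> by simp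
  have N: "finite {1..N}" "0 \<notin> {1..N}"
    by auto
  obtain x where x: "is_arg_min (robust_objective b q d r {1..N}) (\<lambda>z. z \<in> X) x"
    using robust_objective_attains_min[OF assms(2,1,3,4) N \<open>r \<ge> 0\<close>] .
  obtain y where y: "is_arg_min (robust_objective b q d r S) (\<lambda>z. z \<in> X) y"
    using robust_objective_attains_min[OF assms(2,1,3,4) S(1,2) \<open>r \<ge> 0\<close>] .
  then have "y \<in> X"
    by (simp add: is_arg_min_def)
  then obtain s where s: "s \<in> T" "dict_dist d N (q y) s \<le> \<epsilon>"
    using \<open>is_net d N \<epsilon> (q ` X) T\<close> by (auto simp: is_net_def)
  have "finite T"
    using \<open>is_net d N \<epsilon> (q ` X) T\<close> by (simp add: is_net_def)
  have "robust_objective b q d r {1..N} x - robust_objective b q d r S y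
      \<le> robust_objective b q d r {1..N} y - robust_objective b q d r S y"
    using x \<open>y \<in> X\<close> by (simp add: is_arg_min_linorder)
  \<comment> \<open>Both objectives are taken at the same point \<open>y\<close>, so the term
    \<open>b y\<close> cancels.\<close>
  also have "\<dots> = r * alignment_deficit d N S (q y)"
    unfolding robust_objective_eq[OF N \<open>r \<ge> 0\<close>] robust_objective_eq[OF S(1,2) \<open>r \<ge> 0\<close>]
    by (simp add: alignment_deficit_eq right_diff_distrib)
  also have "\<dots> \<le> r * ((MAX s\<in>T. alignment_deficit d N S s) + 2 * \<epsilon>)"
  proof (rule mult_left_mono[OF _ \<open>r \<ge> 0\<close>])
    \<comment> \<open>The bound inside the maximum is at the net point \<open>s\<close> chosen near
      \<open>q y\<close>; passing from \<open>q y\<close> to \<open>s\<close> costs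
      \<open>2 * \<epsilon>\<close>.\<close>
    have "alignment_deficit d N S s \<le> (MAX s\<in>T. alignment_deficit d N S s)"
      using \<open>finite T\<close> s(1) by simp
    then show "alignment_deficit d N S (q y) \<le> (MAX s\<in>T. alignment_deficit d N S s) + 2 * \<epsilon>"
      using alignment_deficit_le_dict_dist[OF S(3), of d "q y" s] s(2) by linarith
  qed
  finally show ?thesis
    using x y by blast
qed

end
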